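(* Let $a$, $b$, $c$ and $n$ be positive integers with $\gcd(a,b)=\gcd(b,c)=\gcd(c,a)=1$, and let $N(a,b,c;n)$ denote the number of triples $(x,y,z)$ of nonnegative integers satisfying $ax+by+cz=n$. Then $$\frac{n(n+a+b+c)}{2abc}-\frac{a+b+c}{2} \;<\; N(a,b,c;n) \;<\; \frac{n(n+a+b+c)}{2abc}+\frac{a+b+c}{2}.$$ *)

theory Defs
  imports Complex_Main
begin

definition num_sols :: "nat \<Rightarrow> nat \<Rightarrow> nat \<Rightarrow> nat \<Rightarrow> nat" where
  "num_sols a b c n = card {(x :: nat, y :: nat, z :: nat). a * x + b * y + c * z = n}"

end

theory Submission
  imports Defs "HOL-Number_Theory.Cong"
begin

text \<open>
  For fixed \<open>z\<close>, Popoviciu's formula counts the pairs \<open>(x, y)\<close> with \<open>a x + b y = m\<close>: there are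
  \<open>m / (a b) + 1 - u / b - v / a\<close> of them, where \<open>u < b\<close> and \<open>v < a\<close> are the quotients \<open>m / a\<close>
  modulo \<open>b\<close> and \<open>m / b\<close> modulo \<open>a\<close>. Here \<open>m\<close> runs through the numbers \<open>n mod c + c j\<close> with
  \<open>j \<le> n div c\<close>, so \<open>v\<close> takes distinct values on every window of \<open>a\<close> consecutive \<open>j\<close>; full
  windows thus contribute exactly the mean \<open>(a - 1) / 2\<close> of \<open>{0, \<dots>, a - 1}\<close> per term, and the sum of
  \<open>v\<close> deviates from its mean value by at most \<open>a\<^sup>2 / 8\<close>. Likewise for \<open>u\<close>. With \<open>u\<close> and \<open>v\<close>
  replaced by their means, the sum over \<open>j\<close> exceeds \<open>n (n + a + b + c) / (2 a b c)\<close> by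
  \<open>(c - r) (r + a + b) / (2 a b c)\<close> with \<open>r = n mod c\<close>, which lies between \<open>0\<close> and \<open>c / 8 + 1\<close>.
\<close>

subsection \<open>Sums of distinct residues\<close>

definition centered :: "nat \<Rightarrow> nat \<Rightarrow> real" where
  "centered a v = real v - (real a - 1) / 2"

lemma sum_real_lessThan: "(\<Sum>i<k. real i) = real k * (real k - 1) / 2"
  by (induction k) (auto simp: field_simps)

lemma gauss_card_le_sum:
  fixes S :: "nat set"
  shows "real (card S) * (real (card S) - 1) / 2 \<le> (\<Sum>v\<in>S. real v)"
proof -
  have "real (card S) * (real (card S) - 1) / 2 = (\<Sum>i<card S. real i)"
    by (rule sum_real_lessThan[symmetric])
  also have "\<dots> \<le> (\<Sum>v\<in>S. real v)"
    using card_sum_le_nat_sum[of S] by (simp add: atLeast0LessThan flip: of_nat_sum)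
  finally show ?thesis .
qed

lemma abs_sum_centered_le:
  assumes "S \<subseteq> {..<a}"
  shows "\<bar>\<Sum>v\<in>S. centered a v\<bar> \<le> real (card S) * (real a - real (card S)) / 2"
proof -
  have "finite S"
    using assms by (rule finite_subset) simp
  have "card S \<le> a"
    using card_mono[OF _ assms] by simp
  then have card_compl: "real (card ({..<a} - S)) = real a - real (card S)"
    using assms \<open>finite S\<close> by (simp add: card_Diff_subset of_nat_diff)
  have sum_compl: "(\<Sum>v\<in>{..<a} - S. real v) = real a * (real a - 1) / 2 - (\<Sum>v\<in>S. real v)"
    using assms by (simp add: sum_diff sum_real_lessThan)
  have "(\<Sum>v\<in>S. centered a v) = (\<Sum>v\<in>S. real v) - real (card S) * (real a - 1) / 2"
    by (simp add: centered_def sum_subtractf)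
  then show ?thesis
    using gauss_card_le_sum[of S] gauss_card_le_sum[of "{..<a} - S"]
    unfolding card_compl sum_compl abs_le_iff by (simp add: field_simps)
qed

lemma abs_sum_centered_inj_on_le:
  assumes "inj_on f A" "f ` A \<subseteq> {..<a}"
  shows "\<bar>\<Sum>x\<in>A. centered a (f x)\<bar> \<le> real (card A) * (real a - real (card A)) / 2"
  using abs_sum_centered_le[OF assms(2)] assms(1) by (simp add: sum.reindex card_image)

lemma abs_sum_centered_windows_le:
  assumes inj: "\<And>k. inj_on f {k..<k + a}" and less: "\<And>j. f j < a"
  shows "\<bar>\<Sum>j<L. centered a (f j)\<bar> \<le> (real a)\<^sup>2 / 8"
proof -
  define q where "q = L div a"
  define s where "s = L mod a"
  have "s \<le> a"
    using less[of 0] by (simp add: s_def)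
  have L_eq: "L = q * a + s"
    by (simp add: q_def s_def)
  have "(\<Sum>j=k..<k + a. centered a (f j)) = 0" for k
    using abs_sum_centered_inj_on_le[OF inj[of k], of a] less by (simp add: image_subset_iff)
  then have "(\<Sum>j<q * a. centered a (f j)) = 0"
    by (simp flip: sum.nat_group)
  then have "(\<Sum>j<L. centered a (f j)) = (\<Sum>j=q * a..<q * a + s. centered a (f j))"
    using sum.atLeastLessThan_concat[of 0 "q * a" L "\<lambda>j. centered a (f j)"]
    by (simp add: L_eq atLeast0LessThan)
  moreover have "inj_on f {q * a..<q * a + s}"
    using inj[of "q * a"] by (rule inj_on_subset) (use \<open>s \<le> a\<close> in auto)
  ultimately have "\<bar>\<Sum>j<L. centered a (f j)\<bar> \<le> real s * (real a - real s) / 2"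
    using abs_sum_centered_inj_on_le[of f "{q * a..<q * a + s}" a] less
    by (simp add: image_subset_iff)
  also have "\<dots> \<le> (real a)\<^sup>2 / 8"
    using zero_le_power2[of "real a - 2 * real s"] by (simp add: power2_eq_square algebra_simps)
  finally show ?thesis .
qed

subsection \<open>Quotients modulo a number\<close>

definition mod_quotient :: "nat \<Rightarrow> nat \<Rightarrow> nat \<Rightarrow> nat" where
  "mod_quotient a b m = (LEAST v. [b * v = m] (mod a))"

lemma cong_mod_quotient:
  assumes "coprime a b"
  shows "[b * mod_quotient a b m = m] (mod a)"
proof -
  have "\<exists>v. [b * v = m] (mod a)"
    using assms by (intro cong_solve_dvd_nat) (simp add: coprime_commute)
  then show ?thesis
    unfolding mod_quotient_def by (rule LeastI_ex)
qed

lemma mod_quotient_less: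
  assumes "a > 0" "coprime a b"
  shows "mod_quotient a b m < a"
proof -
  have "[b * (mod_quotient a b m mod a) = m] (mod a)"
    using cong_mod_quotient[OF assms(2)] by (simp add: cong_def mod_mult_right_eq)
  then have "mod_quotient a b m \<le> mod_quotient a b m mod a"
    unfolding mod_quotient_def by (rule Least_le)
  also have "\<dots> < a"
    using assms(1) by simp
  finally show ?thesis .
qed

lemma mod_quotient_eq_mod:
  assumes "a > 0" "coprime a b" "[b * w = m] (mod a)"
  shows "mod_quotient a b m = w mod a"
proof -
  have "[b * mod_quotient a b m = b * w] (mod a)"
    using cong_mod_quotient[OF assms(2)] assms(3) by (metis cong_sym cong_trans)
  then have "[mod_quotient a b m = w] (mod a)"
    using assms(2) by (simp add: cong_mult_lcancel_nat coprime_commute)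
  then show ?thesis
    using mod_quotient_less[OF assms(1,2)] by (simp add: cong_def)
qed

lemma inj_on_mod_quotient_arith_progression:
  assumes "coprime a b" "coprime a c"
  shows "inj_on (\<lambda>j. mod_quotient a b (r + c * j)) {k..<k + a}"
proof (rule inj_onI)
  fix i j
  assume in_window: "i \<in> {k..<k + a}" "j \<in> {k..<k + a}"
    and "mod_quotient a b (r + c * i) = mod_quotient a b (r + c * j)"
  then have "[r + c * i = r + c * j] (mod a)"
    using cong_mod_quotient[OF assms(1)] by (metis cong_sym cong_trans)
  then have "[k + (i - k) = k + (j - k)] (mod a)"
    using assms(2) in_window by (simp add: cong_add_lcancel_nat cong_mult_lcancel_nat coprime_commute)
  then have "[i - k = j - k] (mod a)"
    by (simp only: cong_add_lcancel_nat)
  then have "i - k = j - k"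
    by (rule cong_less_modulus_unique_nat) (use in_window in auto)
  then show "i = j"
    using in_window by (simp add: eq_diff_iff)
qed

definition mod_quotient_discrepancy :: "nat \<Rightarrow> nat \<Rightarrow> nat \<Rightarrow> nat \<Rightarrow> nat \<Rightarrow> real" where
  "mod_quotient_discrepancy a b c r L
    = (\<Sum>j<L. centered a (mod_quotient a b (r + c * j))) / real a"

lemma abs_mod_quotient_discrepancy_le:
  assumes "a > 0" "coprime a b" "coprime a c"
  shows "\<bar>mod_quotient_discrepancy a b c r L\<bar> \<le> real a / 8"
proof -
  have "\<bar>\<Sum>j<L. centered a (mod_quotient a b (r + c * j))\<bar> \<le> (real a)\<^sup>2 / 8"
    using assms
    by (intro abs_sum_centered_windows_le inj_on_mod_quotient_arith_progression mod_quotient_less)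
  then show ?thesis
    using assms(1) by (simp add: mod_quotient_discrepancy_def abs_divide field_simps power2_eq_square)
qed

subsection \<open>Popoviciu's formula\<close>

definition num_pair_sols :: "nat \<Rightarrow> nat \<Rightarrow> nat \<Rightarrow> nat" where
  "num_pair_sols a b m = card {(x, y). a * x + b * y = m}"

lemma obtain_mod_quotient_multiple:
  assumes "a > 0" "b > 0" "coprime a b"
  obtains k where "m + a * b = a * mod_quotient b a m + b * mod_quotient a b m + a * b * k"
proof -
  define u where "u = mod_quotient b a m"
  define v where "v = mod_quotient a b m"
  have "coprime b a"
    using assms(3) by (simp add: coprime_commute)
  have "[a * u + b * v = m + a * b] (mod b)" "[a * u + b * v = m + a * b] (mod a)"
    using cong_mod_quotient[OF \<open>coprime b a\<close>, of m] cong_mod_quotient[OF assms(3), of m]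
    by (simp_all add: u_def v_def cong_def)
  then have cong_prod: "[m + a * b = a * u + b * v] (mod a * b)"
    using assms(3) by (intro cong_sym[OF coprime_cong_mult_nat])
  have "a * u + b * v \<le> m + a * b"
  proof (rule ccontr)
    assume "\<not> ?thesis"
    moreover from this obtain k where excess: "a * u + b * v = k * (a * b) + (m + a * b)"
      using cong_le_nat[of "m + a * b" "a * u + b * v" "a * b"] cong_prod by (auto simp: cong_sym_eq)
    ultimately have "k > 0"
      by (cases k) auto
    then have "a * b \<le> k * (a * b)"
      by simp
    moreover have "a * u < a * b" "b * v < a * b"
      using mod_quotient_less[OF assms(2) \<open>coprime b a\<close>] mod_quotient_less[OF assms(1,3)] assms
      by (simp_all add: u_def v_def)
    ultimately show False
      using excess by linarith
  qed
  then obtain k where "m + a * b = k * (a * b) + (a * u + b * v)"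
    using cong_prod by (auto simp: cong_le_nat)
  then have "m + a * b = a * u + b * v + a * b * k"
    by (simp add: ac_simps)
  then show thesis
    unfolding u_def v_def by (rule that)
qed

lemma pair_sols_eq_image:
  assumes "a > 0" "b > 0" "coprime a b"
  defines "u \<equiv> mod_quotient b a" and "v \<equiv> mod_quotient a b"
  assumes multiple: "m + a * b = a * u m + b * v m + a * b * k"
  shows "{(x, y). a * x + b * y = m} = (\<lambda>i. (u m + b * i, v m + a * (k - Suc i))) ` {..<k}"
    (is "_ = ?sol ` _")
proof (intro equalityI subrelI)
  fix x y
  assume "(x, y) \<in> {(x, y). a * x + b * y = m}"
  then have solution: "a * x + b * y = m"
    by simp
  then have "[a * x = m] (mod b)" "[b * y = m] (mod a)"
    by (auto simp: cong_def)
  then have "u m = x mod b" "v m = y mod a"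
    unfolding u_def v_def using assms(1-3) by (simp_all add: mod_quotient_eq_mod coprime_commute)
  then obtain i j where x_eq: "x = u m + b * i" and y_eq: "y = v m + a * j"
    by (metis mod_mult_div_eq)
  have "a * b * Suc (i + j) = a * b * k"
    using solution multiple by (simp add: x_eq y_eq algebra_simps)
  then have "Suc (i + j) = k"
    using assms(1,2) by (simp only: mult_cancel1) simp
  then show "(x, y) \<in> ?sol ` {..<k}"
    by (auto simp: x_eq y_eq)
next
  fix x y
  assume "(x, y) \<in> ?sol ` {..<k}"
  then obtain i where "i < k" and x_eq: "x = u m + b * i" and y_eq: "y = v m + a * (k - Suc i)"
    by auto
  then obtain j where "k = Suc (i + j)"
    using less_iff_Suc_add by blast
  then have "a * x + b * y = m"
    using multiple by (simp add: x_eq y_eq algebra_simps)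
  then show "(x, y) \<in> {(x, y). a * x + b * y = m}"
    by simp
qed

theorem popoviciu:
  assumes "a > 0" "b > 0" "coprime a b"
  shows "a * b * num_pair_sols a b m + a * mod_quotient b a m + b * mod_quotient a b m = m + a * b"
proof -
  obtain k where multiple: "m + a * b = a * mod_quotient b a m + b * mod_quotient a b m + a * b * k"
    using obtain_mod_quotient_multiple[OF assms] by blast
  have "inj_on (\<lambda>i. (mod_quotient b a m + b * i, mod_quotient a b m + a * (k - Suc i))) {..<k}"
    using assms by (auto simp: inj_on_def)
  then have "num_pair_sols a b m = k"
    unfolding num_pair_sols_def pair_sols_eq_image[OF assms multiple] by (simp add: card_image)
  then show ?thesis
    using multiple by simp
qed

corollary num_pair_sols_eq_centered:
  assumes "a > 0" "b > 0" "coprime a b"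
  shows "real (num_pair_sols a b m) = (real m + (real a + real b) / 2) / (real a * real b)
    - centered b (mod_quotient b a m) / real b - centered a (mod_quotient a b m) / real a"
proof -
  have "real (a * b * num_pair_sols a b m + a * mod_quotient b a m + b * mod_quotient a b m)
      = real (m + a * b)"
    by (simp only: popoviciu[OF assms])
  then have num_pair_sols: "real (num_pair_sols a b m)
      = (real m + real a * real b - real a * real (mod_quotient b a m)
          - real b * real (mod_quotient a b m)) / (real a * real b)"
    using assms by (simp add: field_simps)
  show ?thesis
    unfolding num_pair_sols centered_def using assms by (simp add: field_simps)
qed

subsection \<open>Solutions in three variables\<close>

lemma finite_pair_sols:
  fixes a b m :: nat
  assumes "a > 0" "b > 0"
  shows "finite {(x, y). a * x + b * y = m}"
proof (rule finite_subset)
  show "{(x, y). a * x + b * y = m} \<subseteq> {..m} \<times> {..m}"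
  proof clarify
    fix x y
    assume "m = a * x + b * y"
    moreover have "x \<le> a * x" "y \<le> b * y"
      using assms by auto
    ultimately show "x \<in> {..a * x + b * y} \<and> y \<in> {..a * x + b * y}"
      by (simp only: atMost_iff) linarith
  qed
qed simp

lemma num_sols_eq_sum_num_pair_sols:
  assumes "a > 0" "b > 0" "c > 0"
  shows "num_sols a b c n = (\<Sum>j<Suc (n div c). num_pair_sols a b (n mod c + c * j))"
proof -
  let ?P = "SIGMA z:{..<Suc (n div c)}. {(x, y). a * x + b * y = n - c * z}"
  have z_iff: "z < Suc (k div c) \<longleftrightarrow> c * z \<le> k" for z k
    using assms by (simp add: less_Suc_eq_le less_eq_div_iff_mult_less_eq mult.commute)
  have "bij_betw (\<lambda>(z, x, y). (x, y, z)) ?P {(x, y, z). a * x + b * y + c * z = n}"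
    by (rule bij_betw_byWitness[where f' = "\<lambda>(x, y, z). (z, x, y)"]) (auto simp: z_iff)
  then have "num_sols a b c n = card ?P"
    unfolding num_sols_def by (simp add: bij_betw_same_card)
  also have "\<dots> = (\<Sum>z<Suc (n div c). num_pair_sols a b (n - c * z))"
    using assms by (simp add: finite_pair_sols num_pair_sols_def)
  also have "\<dots> = (\<Sum>j<Suc (n div c). num_pair_sols a b (n - c * (Suc (n div c) - Suc j)))"
    by (rule sum.nat_diff_reindex[symmetric])
  also have "\<dots> = (\<Sum>j<Suc (n div c). num_pair_sols a b (n mod c + c * j))"
  proof (rule sum.cong)
    fix j
    assume "j \<in> {..<Suc (n div c)}"
    then obtain i where "n div c = j + i"
      by (auto simp: less_Suc_eq_le dest: le_Suc_ex)
    moreover from this have "n = c * (j + i) + n mod c"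
      by (metis mult_div_mod_eq)
    ultimately have "n - c * (Suc (n div c) - Suc j) = n mod c + c * j"
      by (simp add: algebra_simps)
    then show "num_pair_sols a b (n - c * (Suc (n div c) - Suc j))
        = num_pair_sols a b (n mod c + c * j)"
      by simp
  qed simp
  finally show ?thesis .
qed

lemma sum_mod_plus_mult_eq:
  fixes s :: real
  assumes "c > 0"
  shows "(\<Sum>j<Suc (n div c). real (n mod c + c * j) + s)
    = (real n * (real n + 2 * s + real c) + (real c - real (n mod c)) * (real (n mod c) + 2 * s))
        / (2 * real c)"
proof -
  define q where "q = n div c"
  define r where "r = n mod c"
  have "n = c * q + r"
    by (simp add: q_def r_def)
  then have n_eq: "real n = real c * real q + real r"
    by simp
  have "(\<Sum>j<Suc q. real (r + c * j) + s)
      = real (Suc q) * (real r + s) + real c * (\<Sum>j<Suc q. real j)"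
    by (simp only: of_nat_add of_nat_mult sum.distrib sum_constant card_lessThan
        flip: sum_distrib_left) (simp add: algebra_simps)
  also have "\<dots> = (real q + 1) * (2 * real r + 2 * s + real c * real q) / 2"
    unfolding sum_real_lessThan by (simp add: field_simps)
  finally have sum_eq: "(\<Sum>j<Suc q. real (r + c * j) + s)
      = (real q + 1) * (2 * real r + 2 * s + real c * real q) / 2" .
  show ?thesis
    unfolding q_def[symmetric] r_def[symmetric] sum_eq n_eq using assms by (simp add: field_simps)
qed

definition num_sols_main :: "nat \<Rightarrow> nat \<Rightarrow> nat \<Rightarrow> nat \<Rightarrow> real" where
  "num_sols_main a b c n
    = real n * (real n + real a + real b + real c) / (2 * real a * real b * real c)"

definition num_sols_correction :: "real \<Rightarrow> real \<Rightarrow> real \<Rightarrow> real \<Rightarrow> real" where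
  "num_sols_correction a b c r = (c - r) * (r + a + b) / (2 * a * b * c)"

lemma num_sols_eq_main_plus_error:
  assumes "a > 0" "b > 0" "c > 0" "coprime a b"
  shows "real (num_sols a b c n)
    = num_sols_main a b c n + num_sols_correction a b c (n mod c)
      - mod_quotient_discrepancy b a c (n mod c) (Suc (n div c))
      - mod_quotient_discrepancy a b c (n mod c) (Suc (n div c))"
proof -
  let ?average = "(\<Sum>j<Suc (n div c). real (n mod c + c * j) + (real a + real b) / 2)
    / (real a * real b)"
  have "real (num_sols a b c n) = ?average
      - mod_quotient_discrepancy b a c (n mod c) (Suc (n div c))
      - mod_quotient_discrepancy a b c (n mod c) (Suc (n div c))"
    using assms by (simp only: num_sols_eq_sum_num_pair_sols of_nat_sum num_pair_sols_eq_centered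
        mod_quotient_discrepancy_def sum_subtractf sum_divide_distrib)
  also have "?average = num_sols_main a b c n + num_sols_correction a b c (n mod c)"
    unfolding sum_mod_plus_mult_eq[OF assms(3)] num_sols_main_def num_sols_correction_def
    using assms by (simp add: field_simps)
  finally show ?thesis .
qed

lemma num_sols_correction_bounds:
  assumes "a \<ge> 1" "b \<ge> 1" "0 \<le> r" "r < c"
  shows "0 \<le> num_sols_correction a b c r"
    and "num_sols_correction a b c r \<le> c / 8 + 1"
proof -
  show "0 \<le> num_sols_correction a b c r"
    using assms by (simp add: num_sols_correction_def)
  have "(c - r) * r \<le> c\<^sup>2 / 4"
    using zero_le_power2[of "c - 2 * r"] by (simp add: power2_eq_square algebra_simps)
  moreover have "(c - r) * (a + b) \<le> c * (a + b)"
    using assms by (intro mult_right_mono) auto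
  ultimately have "(c - r) * (r + a + b) \<le> c\<^sup>2 / 4 + c * (a + b)"
    by (simp add: algebra_simps)
  then have "num_sols_correction a b c r \<le> (c\<^sup>2 / 4 + c * (a + b)) / (2 * a * b * c)"
    unfolding num_sols_correction_def using assms by (intro divide_right_mono) auto
  also have "\<dots> = c / 8 * (1 / (a * b)) + (1 / a + 1 / b) / 2"
    using assms by (simp add: field_simps power2_eq_square)
  also have "\<dots> \<le> c / 8 * 1 + (1 + 1) / 2"
    using assms by (intro add_mono mult_left_mono divide_right_mono) (auto simp: mult_ge1_I)
  finally show "num_sols_correction a b c r \<le> c / 8 + 1"
    by simp
qed

theorem num_sols_bounds:
  assumes "a > 0" "b > 0" "c > 0" "coprime a b" "coprime b c" "coprime a c"
  shows "num_sols_main a b c n - (real a + real b) / 8 \<le> real (num_sols a b c n)"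
    and "real (num_sols a b c n) \<le> num_sols_main a b c n + (real a + real b + real c) / 8 + 1"
proof -
  let ?U = "mod_quotient_discrepancy b a c (n mod c) (Suc (n div c))"
  let ?V = "mod_quotient_discrepancy a b c (n mod c) (Suc (n div c))"
  have discrepancies: "\<bar>?U\<bar> \<le> real b / 8" "\<bar>?V\<bar> \<le> real a / 8"
    using assms by (intro abs_mod_quotient_discrepancy_le; simp add: coprime_commute)+
  have correction: "0 \<le> num_sols_correction a b c (n mod c)"
    "num_sols_correction a b c (n mod c) \<le> real c / 8 + 1"
    using assms by (simp_all add: num_sols_correction_bounds)
  note error = num_sols_eq_main_plus_error[OF assms(1-4), of n] discrepancies correction
  show "num_sols_main a b c n - (real a + real b) / 8 \<le> real (num_sols a b c n)"
    using error unfolding add_divide_distrib by linarith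
  show "real (num_sols a b c n) \<le> num_sols_main a b c n + (real a + real b + real c) / 8 + 1"
    using error unfolding add_divide_distrib by linarith
qed

theorem theorem2:
  fixes a b c n :: nat
  assumes "a > 0" and "b > 0" and "c > 0" and "n > 0"
    and "gcd a b = 1" and "gcd b c = 1" and "gcd c a = 1"
  shows "real n * (real n + real a + real b + real c) / (2 * real a * real b * real c)
           - (real a + real b + real c) / 2 < real (num_sols a b c n) \<and>
         real (num_sols a b c n)
           < real n * (real n + real a + real b + real c) / (2 * real a * real b * real c)
             + (real a + real b + real c) / 2"
proof -
  have "coprime a b" "coprime b c" "coprime a c"
    using assms by (simp_all add: coprime_iff_gcd_eq_1 gcd.commute)
  note bounds = num_sols_bounds[OF assms(1-3) this, of n]
  have "real a \<ge> 1" "real b \<ge> 1" "real c \<ge> 1"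
    using assms by simp_all
  with bounds show ?thesis
    unfolding num_sols_main_def add_divide_distrib by linarith
qed

end
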